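(* Let $d\ge2$ and let $(A,b)\in M_d(\mathbb{R})\times M_{d,1}(\mathbb{R})$ be a controllable pair. There exists $c>0$ such that, for every $K\in M_{1,d}(\mathbb{R})$ for which the eigenvalues of $A+bK$ have either all real part smaller than $-c$ or all real part larger than $c$, it follows that $K\in\mathrm{LARC}(A-\mathrm{Tr}(A)\mathrm{Id},b)$. In particular, $\mathrm{PLARC}(A,b)$ is dense in $M_{1,d}(\mathbb{R})$.
   Context: $M_{d,m}(\mathbb{R})$ is the set of real $d\times m$ matrices and $M_d(\mathbb{R})=M_{d,d}(\mathbb{R})$. A pair $(A,b)$ is controllable if $b,Ab,\dots,A^{d-1}b$ span $\mathbb{R}^d$. Let $\Pi:\mathbb{R}^d\setminus\{0\}\to\mathbb{RP}^{d-1}$ be the canonical projection. For $A\in M_d(\mathbb{R})$, $\Pi A$ is the vector field on $\mathbb{RP}^{d-1}$ given, for $q=\Pi x$, by $(\Pi A)(q)=d\Pi_x\big(Ax-\frac{\langle x,Ax\rangle}{|x|^2}x\big)$ (Euclidean norm and scalar product). $\mathrm{LARC}(A,b)$ is the set of $K\in M_{1,d}(\mathbb{R})$ such that the Lie algebra generated by $A$ and $bK$ under the matrix commutator equals $M_d(\mathbb{R})$. $\mathrm{PLARC}(A,b)$ is the set of $K\in M_{1,d}(\mathbb{R})$ such that the Lie algebra of vector fields generated by $\Pi A$ and $\Pi(bK)$, evaluated at $q$, equals $T_q\mathbb{RP}^{d-1}$ for every $q\in\mathbb{RP}^{d-1}$. *)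

theory Defs
  imports "HOL-Analysis.Analysis"
begin

text \<open>
  Column and row matrices are the types \<open>real ^ 1 ^ 'n\<close> and \<open>real ^ 'n ^ 1\<close>, so that \<open>b ** K\<close> is
  a square matrix. Note that \<open>*\<close> and \<open>^\<close> on matrices are componentwise; matrix powers
  applied to a vector are therefore written as iterates of \<open>(*v) A\<close>.
\<close>

definition controllable :: "real ^ 'n ^ 'n \<Rightarrow> real ^ 1 ^ 'n \<Rightarrow> bool" where
  "controllable A b \<longleftrightarrow> span {(((*v) A) ^^ k) (column 1 b) | k. k < CARD('n)} = UNIV"

definition eigenvalues :: "real ^ 'n ^ 'n \<Rightarrow> complex set" where
  "eigenvalues M = {z. \<exists>v :: complex ^ 'n. v \<noteq> 0 \<and> map_matrix complex_of_real M *v v = z *s v}"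


subsection \<open>Lie algebras of matrices\<close>

definition matrix_lie_algebra :: "(real ^ 'n ^ 'n) set \<Rightarrow> bool" where
  "matrix_lie_algebra L \<longleftrightarrow> subspace L \<and> (\<forall>X\<in>L. \<forall>Y\<in>L. X ** Y - Y ** X \<in> L)"

definition LARC :: "real ^ 'n ^ 'n \<Rightarrow> real ^ 1 ^ 'n \<Rightarrow> (real ^ 'n ^ 1) set" where
  "LARC A b = {K. matrix_lie_algebra hull {A, b ** K} = UNIV}"


subsection \<open>Real projective space\<close>

text \<open>
  Projective space is taken in its standard model as the compact embedded submanifold of matrix
  space consisting of the orthogonal projections of rank one: the line spanned by \<open>x\<close> is
  represented by the orthogonal projection onto it, with matrix \<open>x x\<^sup>T / |x|\<^sup>2\<close>. Lemma \<open>RP_proj_eq_iff\<close>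
  shows that the fibres of \<open>RP_proj\<close> are exactly the lines without the origin.
\<close>

definition RP_proj :: "real ^ 'n \<Rightarrow> real ^ 'n ^ 'n" where
  "RP_proj x = (\<chi> i j. x $ i * x $ j / (norm x)\<^sup>2)"

definition RP :: "(real ^ 'n ^ 'n) set" where
  "RP = RP_proj ` (UNIV - {0})"

text \<open>Tangent vectors are the velocities of curves contained in the submanifold.\<close>

definition tangent_space :: "'a::real_normed_vector set \<Rightarrow> 'a \<Rightarrow> 'a set" where
  "tangent_space S q = {v. \<exists>\<gamma> :: real \<Rightarrow> 'a.
     (\<forall>t. \<gamma> t \<in> S) \<and> \<gamma> 0 = q \<and> (\<gamma> has_vector_derivative v) (at 0)}"

text \<open>
  A vector field on a submanifold \<open>S\<close> of a normed space is represented by a function on the ambient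
  space which is zero off \<open>S\<close>. The derivative within \<open>S\<close> is not unique as a linear map on the
  ambient space, but it is unique on tangent vectors (lemma \<open>derivative_within_tangent_unique\<close>),
  and only these are inserted when the bracket of tangent vector fields is formed.
\<close>

definition lie_bracket ::
  "'a::real_normed_vector set \<Rightarrow> ('a \<Rightarrow> 'a) \<Rightarrow> ('a \<Rightarrow> 'a) \<Rightarrow> ('a \<Rightarrow> 'a)" where
  "lie_bracket S X Y = (\<lambda>q. if q \<in> S
     then frechet_derivative Y (at q within S) (X q) - frechet_derivative X (at q within S) (Y q)
     else 0)"

definition field_lie_algebra :: "'a::real_normed_vector set \<Rightarrow> ('a \<Rightarrow> 'a) set \<Rightarrow> bool" where
  "field_lie_algebra S L \<longleftrightarrow>
     (\<lambda>q. 0) \<in> L \<and>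
     (\<forall>X\<in>L. \<forall>Y\<in>L. (\<lambda>q. X q + Y q) \<in> L) \<and>
     (\<forall>c. \<forall>X\<in>L. (\<lambda>q. c *\<^sub>R X q) \<in> L) \<and>
     (\<forall>X\<in>L. \<forall>Y\<in>L. lie_bracket S X Y \<in> L)"

text \<open>
  The value at \<open>q = RP_proj x\<close> of the projected linear vector field is independent of the choice of
  \<open>x\<close> (lemma \<open>proj_field_RP_proj\<close>).
\<close>

definition proj_field :: "real ^ 'n ^ 'n \<Rightarrow> real ^ 'n ^ 'n \<Rightarrow> real ^ 'n ^ 'n" where
  "proj_field A q = (if q \<in> RP
     then (let x = (SOME x. x \<noteq> 0 \<and> RP_proj x = q)
           in frechet_derivative RP_proj (at x) (A *v x - ((x \<bullet> (A *v x)) / (norm x)\<^sup>2) *\<^sub>R x))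
     else 0)"

definition PLARC :: "real ^ 'n ^ 'n \<Rightarrow> real ^ 1 ^ 'n \<Rightarrow> (real ^ 'n ^ 1) set" where
  "PLARC A b = {K. \<forall>q\<in>RP.
     (\<lambda>X. X q) ` (field_lie_algebra RP hull {proj_field A, proj_field (b ** K)}) = tangent_space RP q}"


subsection \<open>Well-definedness\<close>

lemma RP_proj_scaleR: "c \<noteq> 0 \<Longrightarrow> RP_proj (c *\<^sub>R x) = RP_proj x"
  by (simp add: RP_proj_def vec_eq_iff power_mult_distrib) (simp add: power2_eq_square)

lemma RP_proj_mult_vec: "RP_proj x *v y = ((x \<bullet> y) / (norm x)\<^sup>2) *\<^sub>R x"
  by (simp add: RP_proj_def vec_eq_iff matrix_vector_mult_def inner_vec_def sum_distrib_left
      sum_divide_distrib mult_ac)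

lemma RP_proj_eq_iff:
  assumes "x \<noteq> 0" "y \<noteq> 0"
  shows "RP_proj x = RP_proj y \<longleftrightarrow> (\<exists>c. c \<noteq> 0 \<and> y = c *\<^sub>R x)"
proof
  assume eq: "RP_proj x = RP_proj y"
  have "y = RP_proj y *v y"
    using assms by (simp add: RP_proj_mult_vec power2_norm_eq_inner)
  also have "\<dots> = ((x \<bullet> y) / (norm x)\<^sup>2) *\<^sub>R x"
    by (simp add: RP_proj_mult_vec flip: eq)
  finally show "\<exists>c. c \<noteq> 0 \<and> y = c *\<^sub>R x"
    using assms by (metis scaleR_zero_left)
qed (auto simp: RP_proj_scaleR)

lemma RP_proj_differentiable:
  fixes x :: "real ^ 'n"
  assumes "x \<noteq> 0"
  shows "RP_proj differentiable (at x)"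
proof -
  have nth: "((\<lambda>x :: real ^ 'n. x $ i) has_derivative (\<lambda>h. h $ i)) (at x)" for i
    by (rule bounded_linear_imp_has_derivative) (rule bounded_linear_vec_nth)
  then have [simp]: "(\<lambda>x :: real ^ 'n. x $ i) differentiable (at x)" for i
    unfolding differentiable_def by blast
  have "(\<lambda>x. x $ i * x $ j / (x \<bullet> x)) differentiable (at x)" for i j
    using assms by (intro differentiable_divide differentiable_mult differentiable_inner) auto
  then show ?thesis
    unfolding differentiable_componentwise_within[of RP_proj]
    by (auto simp: Basis_vec_def inner_axis RP_proj_def power2_norm_eq_inner)
qed

lemma proj_field_RP_proj:
  assumes "x \<noteq> 0"
  shows "proj_field A (RP_proj x) =
    frechet_derivative RP_proj (at x) (A *v x - ((x \<bullet> (A *v x)) / (norm x)\<^sup>2) *\<^sub>R x)"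
proof -
  define y where "y = (SOME y. y \<noteq> 0 \<and> RP_proj y = RP_proj x)"
  have "y \<noteq> 0 \<and> RP_proj y = RP_proj x"
    unfolding y_def by (rule someI[of _ x]) (use assms in simp)
  then obtain c where c: "c \<noteq> 0" "y = c *\<^sub>R x"
    using RP_proj_eq_iff[OF assms, of y] by metis
  define D where "D = frechet_derivative RP_proj (at y)"
  have D: "(RP_proj has_derivative D) (at (c *\<^sub>R x))"
    using RP_proj_differentiable[of y] \<open>y \<noteq> 0 \<and> _\<close> c
    unfolding D_def by (metis frechet_derivative_works)
  have "((\<lambda>x. c *\<^sub>R x) has_derivative (\<lambda>h. c *\<^sub>R h)) (at x)"
    by (rule has_derivative_scaleR_right) (rule has_derivative_ident)
  from has_derivative_compose[OF this D]
  have "(RP_proj has_derivative (\<lambda>h. D (c *\<^sub>R h))) (at x)"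
    using c by (simp add: RP_proj_scaleR)
  then have *: "frechet_derivative RP_proj (at x) = (\<lambda>h. D (c *\<^sub>R h))"
    by (simp add: frechet_derivative_at[symmetric])
  have "A *v y - ((y \<bullet> (A *v y)) / (norm y)\<^sup>2) *\<^sub>R y =
      c *\<^sub>R (A *v x - ((x \<bullet> (A *v x)) / (norm x)\<^sup>2) *\<^sub>R x)"
    using c by (simp add: matrix_vector_mult_scaleR power_mult_distrib scaleR_diff_right)
      (simp add: power2_eq_square)
  then show ?thesis
    using assms by (auto simp: proj_field_def RP_def Let_def * D_def simp flip: y_def)
qed

lemma derivative_within_tangent_unique:
  assumes "(f has_derivative D) (at q within S)" "(f has_derivative E) (at q within S)"
    and "v \<in> tangent_space S q"
  shows "D v = E v"
proof -
  obtain \<gamma> :: "real \<Rightarrow> 'a" where \<gamma>: "\<And>t. \<gamma> t \<in> S" "\<gamma> 0 = q" "(\<gamma> has_vector_derivative v) (at 0)"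
    using assms(3) unfolding tangent_space_def by blast
  have "((\<lambda>t. f (\<gamma> t)) has_vector_derivative F v) (at 0)"
    if F: "(f has_derivative F) (at q within S)" for F
  proof -
    have "(f has_derivative F) (at (\<gamma> 0) within range \<gamma>)"
      using F \<gamma>(1,2) by (auto intro: has_derivative_subset)
    from has_derivative_in_compose[OF \<gamma>(3)[unfolded has_vector_derivative_def] this]
    show ?thesis
      using has_derivative_bounded_linear[OF F]
      by (simp add: has_vector_derivative_def linear_simps)
  qed
  from this[OF assms(1)] this[OF assms(2)] show ?thesis
    by (rule vector_derivative_unique_at)
qed

end

theory Submission
  imports Defs "HOL-Computational_Algebra.Fundamental_Theorem_Algebra"
begin

text \<open>
  Let \<open>k\<close> be the row of \<open>K\<close>. If \<open>s = k b \<noteq> 0\<close>, then \<open>P = b k\<close> satisfies \<open>P\<^sup>2 = s P\<close>, and for \<open>Y\<close> in a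
  Lie algebra containing \<open>P\<close> the brackets \<open>[P, Y]\<close> and \<open>[P, [P, Y]] = s (P Y + Y P) - 2 P Y P\<close> yield
  \<open>P Y\<close> and \<open>Y P\<close> separately. Hence the columns \<open>y\<close> with \<open>y k\<close> in the Lie algebra and the rows \<open>w\<close>
  with \<open>b w\<close> in it form subspaces invariant under \<open>A\<close>; by controllability of \<open>(A, b)\<close> and
  observability of \<open>(k, A)\<close> they are everything, and brackets of the two families give all rank one
  matrices. If \<open>(k, A)\<close> is not observable, \<open>A\<close> and \<open>A + b K\<close> share an eigenvalue, and if \<open>k b = 0\<close>
  they share the trace; both are excluded once the spectrum of \<open>A + b K\<close> is far to one side of the
  imaginary axis.

  For the density, \<open>k b \<noteq> 0\<close> and observability are generic, and projecting matrices to vector fields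
  on projective space is linear, reverses brackets, kills the identity, and is onto the tangent
  space at each point.
\<close>

subsection \<open>Lie algebras containing a rank one matrix\<close>

lemma matrix_sub_ldistrib: "A ** (B - C) = A ** B - A ** C"
  for A :: "'a::ring_1 ^ 'n ^ 'm"
  by (simp add: matrix_matrix_mult_def vec_eq_iff right_diff_distrib sum_subtractf)

lemma matrix_sub_rdistrib: "(A - B) ** C = A ** C - B ** C"
  for A :: "'a::ring_1 ^ 'n ^ 'm"
  by (simp add: matrix_matrix_mult_def vec_eq_iff left_diff_distrib sum_subtractf)

lemma matrix_add_rdistrib: "(A + B) ** C = A ** C + B ** C"
  by (simp add: matrix_matrix_mult_def vec_eq_iff distrib_right sum.distrib)

lemma transpose_add: "transpose (A + B) = transpose A + transpose B"
  by (simp add: transpose_def vec_eq_iff)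

lemma transpose_diff: "transpose (A - B) = transpose A - transpose B"
  by (simp add: transpose_def vec_eq_iff)

lemmas matrix_ring_simps = matrix_add_ldistrib matrix_add_rdistrib matrix_sub_ldistrib
  matrix_sub_rdistrib matrix_scalar_ac scalar_matrix_assoc[symmetric]
  transpose_add transpose_diff transpose_scalar matrix_transpose_mul matrix_mul_assoc[symmetric]

definition outer :: "real ^ 'n \<Rightarrow> real ^ 'm \<Rightarrow> real ^ 'm ^ 'n" where
  "outer x w = (\<chi> i j. x $ i * w $ j)"

lemma column_mult_row: "b ** K = outer (column 1 b) (K $ 1)"
  for b :: "real ^ 1 ^ 'n"
  by (simp add: outer_def vec_eq_iff matrix_matrix_mult_def column_def sum_1)

lemma mult_outer: "A ** outer x w = outer (A *v x) w"
  by (simp add: outer_def vec_eq_iff matrix_matrix_mult_def matrix_vector_mult_def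
      sum_distrib_right mult.assoc)

lemma outer_mult: "outer x w ** A = outer x (w v* A)"
  by (simp add: outer_def vec_eq_iff matrix_matrix_mult_def vector_matrix_mult_def
      sum_distrib_left mult_ac)

lemma outer_scaleR_left: "outer (c *\<^sub>R x) w = c *\<^sub>R outer x w"
  by (simp add: outer_def vec_eq_iff)

lemma outer_scaleR_right: "outer x (c *\<^sub>R w) = c *\<^sub>R outer x w"
  by (simp add: outer_def vec_eq_iff)

lemma outer_add_left: "outer (x + y) w = outer x w + outer y w"
  by (simp add: outer_def vec_eq_iff distrib_right)

lemma outer_add_right: "outer x (v + w) = outer x v + outer x w"
  by (simp add: outer_def vec_eq_iff distrib_left)

lemma outer_diff_left: "outer (x - y) w = outer x w - outer y w"
  by (simp add: outer_def vec_eq_iff left_diff_distrib)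

lemma outer_diff_right: "outer x (v - w) = outer x v - outer x w"
  by (simp add: outer_def vec_eq_iff right_diff_distrib)

lemma outer_zero [simp]: "outer 0 w = 0" "outer x 0 = 0"
  by (simp_all add: outer_def vec_eq_iff)

lemma outer_mult_vec: "outer x w *v v = (w \<bullet> v) *\<^sub>R x"
  by (simp add: outer_def vec_eq_iff matrix_vector_mult_def inner_vec_def sum_distrib_left sum_distrib_right mult_ac)

lemma vec_mult_outer: "v v* outer x w = (v \<bullet> x) *\<^sub>R w"
  by (simp add: outer_def vec_eq_iff vector_matrix_mult_def inner_vec_def sum_distrib_left sum_distrib_right mult_ac)

lemma trace_outer: "trace (outer x w) = x \<bullet> w"
  by (simp add: trace_def outer_def inner_vec_def)

lemma matrix_eq_sum_outer: "M = (\<Sum>i\<in>UNIV. outer (axis i 1) (M $ i))"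
  by (simp add: vec_eq_iff outer_def axis_def if_distrib[of "\<lambda>x. x * _"] cong: if_cong)

text \<open>The two conclusions are the one-sided products \<open>P ** Y\<close> and
  \<open>Y ** P\<close> with \<open>P = outer b k\<close>: the double bracket supplies their sum,
  the single bracket their difference.\<close>

lemma lie_algebra_mult_outer_closed:
  assumes L: "matrix_lie_algebra L" and P: "outer b k \<in> L" and s: "k \<bullet> b \<noteq> 0" and Y: "Y \<in> L"
  shows "outer b (k v* Y) \<in> L" and "outer (Y *v b) k \<in> L"
proof -
  define P where "P = outer b k"
  have br: "X ** Y - Y ** X \<in> L" if "X \<in> L" "Y \<in> L" for X Y
    using L that by (simp add: matrix_lie_algebra_def)
  have sub: "subspace L" using L by (simp add: matrix_lie_algebra_def)
  note P[folded P_def, simp]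
  have 1: "P ** Y - Y ** P \<in> L" using br Y by simp
  have 2: "P ** (P ** Y - Y ** P) - (P ** Y - Y ** P) ** P \<in> L" using br 1 by simp
  have PP: "P ** P = (k \<bullet> b) *\<^sub>R P"
    by (simp add: P_def mult_outer outer_mult_vec outer_scaleR_left)
  \<comment> \<open>Compressing by \<open>P\<close> gives a multiple of \<open>P\<close>, which lies
    in \<open>L\<close> and can be discarded.\<close>
  have PYP: "P ** (Y ** P) = (k \<bullet> (Y *v b)) *\<^sub>R P"
    by (simp add: P_def mult_outer outer_mult_vec outer_scaleR_left)
  have "P ** (P ** Y - Y ** P) - (P ** Y - Y ** P) ** P =
      (k \<bullet> b) *\<^sub>R (P ** Y + Y ** P) - (2 * (k \<bullet> (Y *v b))) *\<^sub>R P"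
  proof -
    have "P ** (P ** Y) = (k \<bullet> b) *\<^sub>R (P ** Y)"
      by (simp add: matrix_mul_assoc PP scalar_matrix_assoc)
    then show ?thesis
      by (simp add: matrix_ring_simps PP PYP) (simp add: vec_eq_iff algebra_simps)
  qed
  with 2 have "(k \<bullet> b) *\<^sub>R (P ** Y + Y ** P) - (2 * (k \<bullet> (Y *v b))) *\<^sub>R P \<in> L" by simp
  then have "(k \<bullet> b) *\<^sub>R (P ** Y + Y ** P) \<in> L"
    using subspace_add[OF sub _ subspace_scale[OF sub \<open>P \<in> L\<close>]] by (metis diff_add_cancel)
  then have "(1 / (k \<bullet> b)) *\<^sub>R (k \<bullet> b) *\<^sub>R (P ** Y + Y ** P) \<in> L"
    by (rule subspace_scale[OF sub])
  then have 3: "P ** Y + Y ** P \<in> L" using s by simp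
  have "(1/2) *\<^sub>R ((P ** Y + Y ** P) + (P ** Y - Y ** P)) \<in> L"
    "(1/2) *\<^sub>R ((P ** Y + Y ** P) - (P ** Y - Y ** P)) \<in> L"
    using 1 3 sub by (meson subspace_add subspace_diff subspace_scale)+
  moreover have "(1/2) *\<^sub>R ((P ** Y + Y ** P) + (P ** Y - Y ** P)) = P ** Y"
    "(1/2) *\<^sub>R ((P ** Y + Y ** P) - (P ** Y - Y ** P)) = Y ** P"
    by (simp_all add: vec_eq_iff)
  ultimately show "outer b (k v* Y) \<in> L" "outer (Y *v b) k \<in> L"
    by (simp_all add: P_def mult_outer outer_mult)
qed

section \<open>Controllability, observability and invariant subspaces\<close>

lemma controllable_invariant_subspace:
  assumes "controllable A b" and U: "subspace U" and "column 1 b \<in> U"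
    and inv: "\<And>x. x \<in> U \<Longrightarrow> A *v x \<in> U"
  shows "U = UNIV"
proof -
  have "(((*v) A) ^^ k) (column 1 b) \<in> U" for k
    by (induction k) (use assms in auto)
  then have "span {(((*v) A) ^^ k) (column 1 b) | k. k < CARD('a)} \<subseteq> U"
    by (intro span_minimal U) auto
  then show ?thesis using assms(1) by (auto simp: controllable_def)
qed

text \<open>The dual of controllability. All powers of \<open>A\<close> are allowed, which by
  Cayley-Hamilton amounts to those below the dimension.\<close>

definition observable :: "real ^ 'n ^ 'n \<Rightarrow> real ^ 'n \<Rightarrow> bool" where
  "observable A k \<longleftrightarrow> (\<forall>v. (\<forall>i. k \<bullet> (((*v) A) ^^ i) v = 0) \<longrightarrow> v = 0)"

text \<open>A nonzero \<open>v\<close> orthogonal to a proper \<open>W\<close> satisfies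
  \<open>w A^i v = 0\<close> for all \<open>w\<close> in \<open>W\<close>, by moving one factor
  \<open>A\<close> at a time onto \<open>w\<close>; the case \<open>w = k\<close> contradicts
  observability.\<close>

lemma observable_invariant_subspace:
  assumes obs: "observable A k" and W: "subspace W" and k: "k \<in> W"
    and inv: "\<And>w. w \<in> W \<Longrightarrow> w v* A \<in> W"
  shows "W = UNIV"
proof (rule ccontr)
  assume "W \<noteq> UNIV"
  then have "span W \<subset> UNIV" using W by (metis span_eq_iff top.not_eq_extremum)
  then obtain v where v: "v \<noteq> 0" "\<And>w. w \<in> span W \<Longrightarrow> orthogonal v w"
    using orthogonal_to_subspace_exists_gen[of W UNIV] by auto
  have "\<forall>w\<in>W. w \<bullet> (((*v) A) ^^ i) v = 0" for i
  proof (induction i)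
    case 0
    then show ?case using v by (auto simp: orthogonal_def inner_commute span_base)
  next
    case (Suc i)
    then show ?case using inv by (auto simp flip: dot_lmul_matrix)
  qed
  with k obs v show False by (auto simp: observable_def)
qed

lemma lie_algebra_controllable_observable:
  assumes L: "matrix_lie_algebra L" and A: "A - c *\<^sub>R mat 1 \<in> L" and P: "b ** K \<in> L"
    and ctr: "controllable A b" and obs: "observable A (K $ 1)"
    and s: "(K $ 1) \<bullet> column 1 b \<noteq> 0"
  shows "L = UNIV"
proof -
  define k where "k = K $ 1"
  define x where "x = column 1 b"
  define C where "C = A - c *\<^sub>R mat 1"
  have P: "outer x k \<in> L" using P by (simp add: column_mult_row k_def x_def)
  have C: "C \<in> L" using A by (simp add: C_def)
  have s: "k \<bullet> x \<noteq> 0" using s by (simp add: k_def x_def)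
  have sub: "subspace L" and br: "\<And>X Y. X \<in> L \<Longrightarrow> Y \<in> L \<Longrightarrow> X ** Y - Y ** X \<in> L"
    using L by (auto simp: matrix_lie_algebra_def)
  \<comment> \<open>Each bracket below gives a nonzero multiple of the wanted element, up to a
    multiple of an element already in \<open>L\<close>.\<close>
  have cancel: "v \<in> L" if "a *\<^sub>R v - r *\<^sub>R w \<in> L" "w \<in> L" "a \<noteq> 0" for a r v w
  proof -
    have "a *\<^sub>R v \<in> L"
      using subspace_add[OF sub that(1) subspace_scale[OF sub that(2), of r]] by simp
    then show ?thesis
      using subspace_scale[OF sub, of "a *\<^sub>R v" "1 / a"] that(3) by simp
  qed
  have Av: "A *v y = C *v y + c *\<^sub>R y" "y v* A = y v* C + c *\<^sub>R y" for y
    by (simp_all add: C_def algebra_simps scaleR_matrix_vector_assoc[symmetric]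
        vector_matrix_mult_diff_rdistrib vector_scaleR_matrix_ac)
  have "{y. outer y k \<in> L} = UNIV"
  proof (rule controllable_invariant_subspace[OF ctr])
    show "subspace {y. outer y k \<in> L}"
      using sub by (auto simp: subspace_def outer_add_left outer_scaleR_left)
    fix y assume "y \<in> {y. outer y k \<in> L}"
    then have y: "outer y k \<in> L" by simp
    \<comment> \<open>The bracket of \<open>C\<close> with \<open>outer y k\<close> contains the row
      \<open>k v* C\<close>; multiplying by \<open>outer x k\<close> on the right restores the row
      \<open>k\<close>.\<close>
    have "outer ((C ** outer y k - outer y k ** C) *v x) k \<in> L"
      by (rule lie_algebra_mult_outer_closed(2)[OF L P s]) (use br C y in auto)
    moreover have "(C ** outer y k - outer y k ** C) *v x = (k \<bullet> x) *\<^sub>R (C *v y) - (k \<bullet> (C *v x)) *\<^sub>R y"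
      by (simp add: algebra_simps mult_outer outer_mult outer_mult_vec dot_lmul_matrix)
    ultimately have "outer (C *v y) k \<in> L"
      using cancel y s by (metis outer_diff_left outer_scaleR_left)
    then show "A *v y \<in> {y. outer y k \<in> L}"
      using y sub by (simp add: Av outer_add_left outer_scaleR_left subspace_add subspace_scale)
  qed (use P x_def in simp)
  then have U: "outer y k \<in> L" for y by auto
  have "{w. outer x w \<in> L} = UNIV"
  proof (rule observable_invariant_subspace[OF obs])
    show "subspace {w. outer x w \<in> L}"
      using sub by (auto simp: subspace_def outer_add_right outer_scaleR_right)
    fix w assume "w \<in> {w. outer x w \<in> L}"
    then have w: "outer x w \<in> L" by simp
    have "outer x (k v* (outer x w ** C - C ** outer x w)) \<in> L"
      by (rule lie_algebra_mult_outer_closed(1)[OF L P s]) (use br C w in auto)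
    moreover have "k v* (outer x w ** C - C ** outer x w) =
        (k \<bullet> x) *\<^sub>R (w v* C) - (k \<bullet> (C *v x)) *\<^sub>R w"
      by (simp add: vector_matrix_mult_diff_rdistrib mult_outer outer_mult vec_mult_outer)
    ultimately have "outer x (w v* C) \<in> L"
      using cancel w s by (metis outer_diff_right outer_scaleR_right)
    then show "w v* A \<in> {w. outer x w \<in> L}"
      using w sub by (simp add: Av outer_add_right outer_scaleR_right subspace_add subspace_scale)
  qed (use P k_def in simp)
  then have W: "outer x w \<in> L" for w by auto
  have "outer y w \<in> L" for y w
  proof -
    have "outer y k ** outer x w - outer x w ** outer y k =
        (k \<bullet> x) *\<^sub>R outer y w - (w \<bullet> y) *\<^sub>R outer x k"
      by (simp add: mult_outer outer_mult_vec outer_scaleR_left)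
    then show ?thesis using cancel br[OF U W] P s by metis
  qed
  then have "M \<in> L" for M
    by (subst matrix_eq_sum_outer) (intro subspace_sum sub)
  then show ?thesis by auto
qed

text \<open>The multiple of the identity is free: it is \<open>trace A\<close> for the spectral
  criterion and \<open>0\<close> for the density.\<close>

lemma LARC_I:
  fixes A :: "real ^ 'n ^ 'n"
  assumes "controllable A b" "observable A (K $ 1)" "(K $ 1) \<bullet> column 1 b \<noteq> 0"
  shows "K \<in> LARC (A - c *\<^sub>R mat 1) b"
proof -
  let ?S = "{A - c *\<^sub>R mat 1, b ** K}"
  have "matrix_lie_algebra (matrix_lie_algebra hull ?S)"
    by (rule hull_in) (auto simp: matrix_lie_algebra_def subspace_Inter)
  then have "matrix_lie_algebra hull ?S = UNIV"
    by (rule lie_algebra_controllable_observable) (use assms hull_subset[of ?S] in auto)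
  then show ?thesis by (simp add: LARC_def)
qed

subsection \<open>Characteristic polynomial and trace\<close>

definition charpoly :: "'a::comm_ring_1 ^ 'n ^ 'n \<Rightarrow> 'a poly" where
  "charpoly M = det (\<chi> i j. [:- M $ i $ j, if i = j then 1 else 0:])"

lemma mat_mult_vec: "mat z *v v = z *s v" for z :: "'a::comm_semiring_1"
  by (simp add: vec_eq_iff matrix_vector_mult_def mat_def if_distrib[of "\<lambda>x. x * _"] cong: if_cong)

lemma poly_charpoly: "poly (charpoly M) z = det (mat z - M)"
  by (simp add: charpoly_def det_def poly_sum poly_prod mat_def if_distrib cong: if_cong)
    (intro sum.cong prod.cong arg_cong2[of _ _ _ _ times] refl; simp)

lemma poly_charpoly_eq_0_iff:
  fixes M :: "'a::field ^ 'n ^ 'n"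
  shows "poly (charpoly M) z = 0 \<longleftrightarrow> (\<exists>v. v \<noteq> 0 \<and> M *v v = z *s v)"
proof -
  have "det (mat z - M) = 0 \<longleftrightarrow> \<not> (\<exists>B. B ** (mat z - M) = mat 1)"
    using invertible_det_nz invertible_left_inverse by blast
  also have "\<dots> \<longleftrightarrow> (\<exists>v. v \<noteq> 0 \<and> (mat z - M) *v v = 0)"
    unfolding matrix_left_invertible_ker by blast
  also have "\<dots> \<longleftrightarrow> (\<exists>v. v \<noteq> 0 \<and> M *v v = z *s v)"
    by (simp add: matrix_vector_mult_diff_rdistrib mat_mult_vec) metis
  finally show ?thesis by (simp add: poly_charpoly)
qed

text \<open>The first two Vieta coefficients, by induction on the multiset. The
  \<open>pCons 0\<close> shifts the index \<open>size Z - 1\<close> up by one, so that the empty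
  multiset is no exception.\<close>

lemma coeff_prod_mset_linear_factors:
  fixes Z :: "'a::comm_ring_1 multiset"
  shows "degree (\<Prod>x\<in>#Z. [:- x, 1:]) \<le> size Z"
    and "coeff (\<Prod>x\<in>#Z. [:- x, 1:]) (size Z) = 1"
    and "coeff (pCons 0 (\<Prod>x\<in>#Z. [:- x, 1:])) (size Z) = - sum_mset Z"
proof -
  let ?p = "\<lambda>Z. \<Prod>x\<in>#Z. [:- x, 1:] :: 'a poly"
  have "degree (?p Z) \<le> size Z \<and> coeff (?p Z) (size Z) = 1 \<and>
      coeff (pCons 0 (?p Z)) (size Z) = - sum_mset Z"
  proof (induction Z)
    case (add x Z)
    have "degree (?p (add_mset x Z)) \<le> degree [:- x, 1:] + degree (?p Z)"
      by (simp only: image_mset_add_mset prod_mset.add_mset degree_mult_le)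
    also have "\<dots> \<le> Suc (size Z)" using add by (auto intro: order_trans[OF degree_pCons_le])
    finally show ?case using add by (simp add: coeff_eq_0)
  qed auto
  then show "degree (?p Z) \<le> size Z" "coeff (?p Z) (size Z) = 1"
    "coeff (pCons 0 (?p Z)) (size Z) = - sum_mset Z" by auto
qed

text \<open>A permutation other than the identity moves at least two points.\<close>
lemma coeff_charpoly_eq_diagonal:
  fixes M :: "'a::comm_ring_1 ^ 'n ^ 'n"
  assumes "CARD('n) \<le> Suc m"
  shows "coeff (charpoly M) m = coeff (\<Prod>i\<in>UNIV. [:- M $ i $ i, 1:]) m"
proof -
  let ?e = "\<lambda>p i. [:- M $ i $ p i, if i = p i then 1 else 0:]"
  have "coeff (of_int (sign p) * (\<Prod>i\<in>UNIV. ?e p i)) m = 0"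
    if p: "p permutes (UNIV :: 'n set)" "p \<noteq> id" for p
  proof -
    obtain i where i: "p i \<noteq> i" using p(2) by (auto simp: fun_eq_iff)
    then have pi: "p (p i) \<noteq> p i" using permutes_inj[OF p(1)] by (auto dest: injD)
    have "degree (of_int (sign p) * (\<Prod>i\<in>UNIV. ?e p i)) \<le>
        degree (of_int (sign p) :: 'a poly) + degree (\<Prod>i\<in>UNIV. ?e p i)"
      by (rule degree_mult_le)
    also have "\<dots> = degree (\<Prod>i\<in>UNIV. ?e p i)" by simp
    also have "\<dots> \<le> (\<Sum>i\<in>UNIV. degree (?e p i))"
      using degree_prod_sum_le[of UNIV "?e p"] by (simp add: o_def)
    also have "\<dots> \<le> (\<Sum>j\<in>UNIV. if p j = j then 1 else 0)"
      by (intro sum_mono) (auto intro: order_trans[OF degree_pCons_le])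
    also have "\<dots> = card {j. p j = j}" by (simp add: sum.If_cases)
    also have "\<dots> \<le> card (UNIV - {i, p i})"
      by (intro card_mono) (use i pi in auto)
    also have "\<dots> = CARD('n) - 2" using i by (subst card_Diff_subset) auto
    \<comment> \<open>The subtraction of 2 truncates only when the dimension is at most 1; that case
      is excluded by the two distinct points \<open>i\<close> and \<open>p i\<close>.\<close>
    finally have "degree (of_int (sign p) * (\<Prod>i\<in>UNIV. ?e p i)) < m \<or> m = 0 \<and> CARD('n) \<le> 1"
      using assms by arith
    then show ?thesis
    proof
      assume "m = 0 \<and> CARD('n) \<le> 1"
      moreover have "card {i, p i} \<le> CARD('n)" by (intro card_mono) auto
      ultimately show ?thesis using i by simp
    qed (rule coeff_eq_0)
  qed
  then have "coeff (charpoly M) m =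
      (\<Sum>p | p permutes (UNIV :: 'n set). if p = id then coeff (\<Prod>i\<in>UNIV. ?e p i) m else 0)"
    unfolding charpoly_def det_def coeff_sum by (intro sum.cong) auto
  then show ?thesis by (simp add: permutes_id)
qed

lemma coeff_charpoly:
  fixes M :: "'a::comm_ring_1 ^ 'n ^ 'n"
  shows "coeff (charpoly M) (CARD('n)) = 1" and "coeff (charpoly M) (CARD('n) - 1) = - trace M"
    and "CARD('n) < m \<Longrightarrow> coeff (charpoly M) m = 0"
proof -
  define Z where "Z = image_mset (\<lambda>i. M $ i $ i) (mset_set UNIV)"
  have size: "size Z = CARD('n)" by (simp add: Z_def)
  have p: "(\<Prod>i\<in>UNIV. [:- M $ i $ i, 1:]) = (\<Prod>x\<in>#Z. [:- x, 1:])"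
    by (simp add: Z_def prod_unfold_prod_mset image_mset.compositionality o_def)
  have tr: "trace M = sum_mset Z" by (simp add: trace_def Z_def sum_unfold_sum_mset)
  obtain n where n: "CARD('n) = Suc n" using gr0_implies_Suc[OF zero_less_card_finite] by blast
  note c = coeff_prod_mset_linear_factors[of Z, unfolded size]
  show "coeff (charpoly M) (CARD('n)) = 1"
    by (subst coeff_charpoly_eq_diagonal) (use c p in auto)
  show "coeff (charpoly M) (CARD('n) - 1) = - trace M"
    by (subst coeff_charpoly_eq_diagonal) (use c p n tr in auto)
  show "coeff (charpoly M) m = 0" if "CARD('n) < m"
    by (subst coeff_charpoly_eq_diagonal) (use c(1) p that in \<open>auto simp: coeff_eq_0\<close>)
qed

lemma finite_eigenvalues:
  fixes M :: "'a::field ^ 'n ^ 'n"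
  shows "finite {z. \<exists>v. v \<noteq> 0 \<and> M *v v = z *s v}"
proof -
  have "charpoly M \<noteq> 0" using coeff_charpoly(1)[of M] by auto
  then show ?thesis using poly_roots_finite by (simp flip: poly_charpoly_eq_0_iff)
qed

text \<open>The coefficient below the leading one is read off twice, from the determinant and from
  the factorization into linear factors. The multiset records algebraic multiplicities.\<close>

lemma trace_eq_sum_eigenvalues:
  fixes M :: "'a::alg_closed_field ^ 'n ^ 'n"
  shows "\<exists>Z. size Z = CARD('n) \<and> trace M = sum_mset Z \<and>
    (\<forall>z\<in>#Z. \<exists>v. v \<noteq> 0 \<and> M *v v = z *s v)"
proof -
  have nz: "charpoly M \<noteq> 0" using coeff_charpoly(1)[of M] by auto
  have deg: "degree (charpoly M) = CARD('n)"
    using coeff_charpoly(1)[of M] coeff_charpoly(3)[where M = M]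
    by (intro antisym degree_le le_degree) auto
  obtain Z where Z: "size Z = degree (charpoly M)"
    "charpoly M = smult (lead_coeff (charpoly M)) (\<Prod>x\<in>#Z. [:- x, 1:])"
    using alg_closed_imp_factorization[OF nz] by blast
  have eq: "charpoly M = (\<Prod>x\<in>#Z. [:- x, 1:])" using Z(2) coeff_charpoly(1)[of M] deg by simp
  obtain n where n: "CARD('n) = Suc n" using gr0_implies_Suc[OF zero_less_card_finite] by blast
  have "- trace M = - sum_mset Z"
    using coeff_charpoly(2)[of M] coeff_prod_mset_linear_factors(3)[of Z] Z(1) deg n
    by (simp add: eq)
  moreover have "\<exists>v. v \<noteq> 0 \<and> M *v v = z *s v" if "z \<in># Z" for z
    unfolding poly_charpoly_eq_0_iff[symmetric] eq
    using that by (auto simp: poly_prod_mset image_mset.compositionality o_def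
        dest!: multi_member_split)
  ultimately show ?thesis using Z(1) deg by auto
qed

section \<open>Bounds on the spectrum and the trace\<close>

lemma size_mult_le_Re_sum_mset:
  "(\<And>z. z \<in># Z \<Longrightarrow> c \<le> Re z) \<Longrightarrow> real (size Z) * c \<le> Re (sum_mset Z)"
proof (induction Z)
  case (add x Z)
  then have "real (size Z) * c \<le> Re (sum_mset Z)" "c \<le> Re x" by auto
  then show ?case by (simp add: algebra_simps)
qed auto

lemma Re_sum_mset_le_size_mult:
  "(\<And>z. z \<in># Z \<Longrightarrow> Re z \<le> c) \<Longrightarrow> Re (sum_mset Z) \<le> real (size Z) * c"
proof (induction Z)
  case (add x Z)
  then have "Re (sum_mset Z) \<le> real (size Z) * c" "Re x \<le> c" by auto
  then show ?case by (simp add: algebra_simps)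
qed auto

text \<open>The trace is a sum of at least one eigenvalue, and real parts of one sign cannot
  cancel.\<close>

lemma abs_trace_ge:
  fixes M :: "real ^ 'n ^ 'n"
  assumes "c \<ge> 0" and "(\<forall>z\<in>eigenvalues M. Re z < - c) \<or> (\<forall>z\<in>eigenvalues M. Re z > c)"
  shows "c \<le> \<bar>trace M\<bar>"
proof -
  obtain Z where Z: "size Z = CARD('n)" "trace (map_matrix complex_of_real M) = sum_mset Z"
    "\<And>z. z \<in># Z \<Longrightarrow> z \<in> eigenvalues M"
    using trace_eq_sum_eigenvalues[of "map_matrix complex_of_real M"]
    by (auto simp: eigenvalues_def)
  have "trace (map_matrix complex_of_real M) = complex_of_real (trace M)"
    by (simp add: trace_def map_matrix_def)
  then have tr: "trace M = Re (sum_mset Z)" using Z(2) by (metis Re_complex_of_real)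
  have "real CARD('n) \<ge> 1" using zero_less_card_finite[where 'a='n] by linarith
  then have n: "c \<le> real CARD('n) * c" using assms(1) mult_right_mono[of 1 "real CARD('n)" c] by simp
  show ?thesis
    using assms(2)
  proof
    assume "\<forall>z\<in>eigenvalues M. Re z < - c"
    then have "Re (sum_mset Z) \<le> real (size Z) * (- c)"
      using Z(3) by (intro Re_sum_mset_le_size_mult) force
    then show ?thesis using n tr Z(1) by simp
  next
    assume "\<forall>z\<in>eigenvalues M. Re z > c"
    then have "real (size Z) * c \<le> Re (sum_mset Z)"
      using Z(3) by (intro size_mult_le_Re_sum_mset) force
    then show ?thesis using n tr Z(1) by simp
  qed
qed

lemma eigenvalues_bounded:
  fixes A :: "real ^ 'n ^ 'n"
  obtains B where "\<And>z. z \<in> eigenvalues A \<Longrightarrow> \<bar>Re z\<bar> \<le> B"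
proof -
  have "finite (eigenvalues A)" unfolding eigenvalues_def by (rule finite_eigenvalues)
  then have "\<bar>Re z\<bar> \<le> Max ((\<lambda>z. \<bar>Re z\<bar>) ` eigenvalues A)" if "z \<in> eigenvalues A" for z
    using that by (intro Max_ge) auto
  then show ?thesis using that by blast
qed

subsection \<open>Observability and eigenvectors\<close>

text \<open>The vector \<open>p(M) v\<close> by Horner's scheme, without forming powers of the
  matrix.\<close>

definition poly_apply :: "'a::field ^ 'n ^ 'n \<Rightarrow> 'a poly \<Rightarrow> 'a ^ 'n \<Rightarrow> 'a ^ 'n" where
  "poly_apply M p v = fold_coeffs (\<lambda>a w. a *s v + M *v w) p 0"

lemma poly_apply_0 [simp]: "poly_apply M 0 v = 0"
  by (simp add: poly_apply_def)

lemma poly_apply_pCons [simp]: "poly_apply M (pCons a p) v = a *s v + M *v poly_apply M p v"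
  by (cases "a = 0 \<and> p = 0") (auto simp: poly_apply_def)

lemma poly_apply_add: "poly_apply M (p + q) v = poly_apply M p v + poly_apply M q v"
  by (induction p q rule: poly_induct2)
    (auto simp: matrix_vector_right_distrib vector_sadd_rdistrib algebra_simps)

lemma poly_apply_smult: "poly_apply M (smult c p) v = c *s poly_apply M p v"
  by (induction p) (auto simp: vector_add_ldistrib vector_smult_assoc vector_scalar_commute)

lemma poly_apply_monom: "poly_apply M (monom c i) v = c *s (((*v) M) ^^ i) v"
  by (induction i) (auto simp: monom_0 monom_Suc vector_scalar_commute)

lemma poly_apply_sum: "poly_apply M (sum f S) v = (\<Sum>i\<in>S. poly_apply M (f i) v)"
  by (induction S rule: infinite_finite_induct) (auto simp: poly_apply_add)

lemma poly_apply_linear_factor: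
  "poly_apply M ([:- z, 1:] * r) v = M *v poly_apply M r v - z *s poly_apply M r v"
proof -
  have "[:- z, 1:] * r = smult (- z) r + pCons 0 r" by simp
  then show ?thesis
    by (simp only: poly_apply_add poly_apply_smult poly_apply_pCons) (simp add: vec_eq_iff)
qed

text \<open>In dimension \<open>d\<close> the \<open>d + 1\<close> vectors
  \<open>v, M v, ..., M^d v\<close> are dependent. Dependence concerns sets, so a repeated iterate
  is a separate case, settled by a difference of two monomials.\<close>

lemma annihilating_polynomial_exists:
  fixes M :: "'a::field ^ 'n ^ 'n"
  obtains p where "p \<noteq> 0" "poly_apply M p v = 0"
proof -
  define f where "f i = (((*v) M) ^^ i) v" for i
  define N where "N = {..CARD('n)}"
  show ?thesis
  proof (cases "inj_on f N")
    case True
    then have "card (f ` N) = Suc (CARD('n))" by (simp add: card_image N_def)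
    then have "vec.dependent (f ` N)"
      using vec.independent_card_le_dim[of "f ` N" UNIV] by (auto simp: card_cart_basis)
    moreover have "finite (f ` N)" by (simp add: N_def)
    ultimately obtain u where u: "\<exists>x\<in>f ` N. u x \<noteq> 0" "(\<Sum>x\<in>f ` N. u x *s x) = 0"
      using vec.dependent_finite[of "f ` N"] by blast
    define p where "p = (\<Sum>i\<in>N. monom (u (f i)) i)"
    have "coeff p i = u (f i)" if "i \<in> N" for i
      using that by (simp add: p_def coeff_sum N_def)
    then have "p \<noteq> 0" using u(1) by force
    moreover have "poly_apply M p v = 0"
      using u(2) True by (simp add: p_def poly_apply_sum poly_apply_monom sum.reindex flip: f_def)
    ultimately show ?thesis using that by blast
  next
    case False
    then obtain i j where ij: "i \<noteq> j" "f i = f j" by (auto simp: inj_on_def)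
    have "poly_apply M (monom 1 i + monom (- 1) j) v = 0"
      using ij by (simp add: poly_apply_add poly_apply_monom flip: f_def)
    moreover have "coeff (monom 1 i + monom (- 1 :: 'a) j) i = 1" using ij by simp
    ultimately show ?thesis using that by (metis coeff_0 zero_neq_one)
  qed
qed

text \<open>Split a root \<open>z\<close> off an annihilating polynomial of least degree: the
  cofactor \<open>r\<close> does not annihilate \<open>v\<close>, so \<open>r(M) v\<close> is an
  eigenvector. Lying in the span of the orbit of \<open>v\<close>, it inherits linear conditions on
  that orbit.\<close>

lemma eigenvector_in_orbit:
  fixes M :: "'a::alg_closed_field ^ 'n ^ 'n"
  assumes "v \<noteq> 0"
  obtains r z where "poly_apply M r v \<noteq> 0" "M *v poly_apply M r v = z *s poly_apply M r v"
proof -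
  obtain p where p: "p \<noteq> 0" "poly_apply M p v = 0"
    and min: "\<And>q. q \<noteq> 0 \<Longrightarrow> poly_apply M q v = 0 \<Longrightarrow> degree p \<le> degree q"
    using annihilating_polynomial_exists[of M v]
      ex_has_least_nat[of "\<lambda>p. p \<noteq> 0 \<and> poly_apply M p v = 0" _ degree] by metis
  have "degree p \<noteq> 0"
  proof
    assume "degree p = 0"
    then obtain c where "p = [:c:]" by (rule degree_eq_zeroE)
    then show False using p assms by simp
  qed
  then obtain z where "poly p z = 0" using alg_closed_imp_poly_has_root by blast
  then obtain r where r: "p = [:- z, 1:] * r" by (auto simp: poly_eq_0_iff_dvd elim: dvdE)
  then have "r \<noteq> 0" using p by auto
  then have "degree p = Suc (degree r)" unfolding r by (subst degree_mult_eq) auto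
  then have "poly_apply M r v \<noteq> 0" using min[OF \<open>r \<noteq> 0\<close>] by auto
  moreover have "M *v poly_apply M r v = z *s poly_apply M r v"
    using p(2) unfolding r poly_apply_linear_factor by simp
  ultimately show ?thesis using that by blast
qed

text \<open>An unobservable vector yields a complex eigenvector \<open>u\<close> of \<open>A\<close>
  killed by the row \<open>K $ 1\<close>, so \<open>A\<close> and \<open>A + b ** K\<close> agree on
  \<open>u\<close>.\<close>

lemma not_observable_common_eigenvalue:
  fixes A :: "real ^ 'n ^ 'n" and b :: "real ^ 1 ^ 'n"
  assumes "\<not> observable A (K $ 1)"
  obtains z where "z \<in> eigenvalues A" "z \<in> eigenvalues (A + b ** K)"
proof -
  obtain v where v: "v \<noteq> 0" "\<And>i. (K $ 1) \<bullet> (((*v) A) ^^ i) v = 0"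
    using assms by (auto simp: observable_def)
  define C where "C w = (\<chi> i. complex_of_real (w $ i))" for w :: "real ^ 'n"
  define M where "M = map_matrix complex_of_real A"
  define h where "h u = (\<Sum>j\<in>UNIV. complex_of_real (K $ 1 $ j) * u $ j)" for u
  have C: "M *v C w = C (A *v w)" for w
    by (simp add: C_def M_def vec_eq_iff matrix_vector_mult_def map_matrix_def)
  have iter: "(((*v) M) ^^ i) (C v) = C ((((*v) A) ^^ i) v)" for i
    by (induction i) (auto simp: C)
  have h0: "h (C w) = complex_of_real ((K $ 1) \<bullet> w)" for w
    by (simp add: h_def C_def inner_vec_def)
  have add: "h (x + y) = h x + h y" for x y
    by (simp add: h_def distrib_left sum.distrib)
  have scale: "h (c *s x) = c * h x" for x c
    by (simp add: h_def sum_distrib_left mult_ac)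
  have "C v \<noteq> 0" using v(1) by (auto simp: C_def vec_eq_iff)
  then obtain r z where r: "poly_apply M r (C v) \<noteq> 0"
    "M *v poly_apply M r (C v) = z *s poly_apply M r (C v)"
    by (rule eigenvector_in_orbit)
  define u where "u = poly_apply M r (C v)"
  \<comment> \<open>All \<open>i\<close> are treated together because a factor of the indeterminate
    raises the power of \<open>M\<close> by one.\<close>
  have "\<forall>i. h ((((*v) M) ^^ i) (poly_apply M q (C v))) = 0" for q
  proof (induction q)
    case 0
    have "(((*v) M) ^^ i) 0 = 0" for i by (induction i) auto
    then show ?case by (simp add: h_def)
  next
    case (pCons a q)
    have lin: "(((*v) M) ^^ i) (a *s x + M *v y) = a *s (((*v) M) ^^ i) x + (((*v) M) ^^ Suc i) y"
      for i x y
      by (induction i) (auto simp: matrix_vector_right_distrib vector_scalar_commute)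
    show ?case
    proof
      fix i
      have "h ((((*v) M) ^^ Suc i) (poly_apply M q (C v))) = 0" using pCons by blast
      then show "h ((((*v) M) ^^ i) (poly_apply M (pCons a q) (C v))) = 0"
        unfolding poly_apply_pCons lin add scale iter h0 v(2) by simp
    qed
  qed
  from this[of r] have hu: "h u = 0" unfolding u_def by (metis funpow_0)
  have "map_matrix complex_of_real (A + b ** K) *v u =
      M *v u + h u *s (\<chi> i. complex_of_real (b $ i $ 1))"
    by (simp add: vec_eq_iff matrix_vector_mult_def map_matrix_def M_def h_def matrix_matrix_mult_def
        sum_1 algebra_simps sum.distrib sum_distrib_left)
  then have "z \<in> eigenvalues (A + b ** K)"
    using r hu by (auto simp: eigenvalues_def u_def)
  moreover have "z \<in> eigenvalues A"
    using r by (auto simp: eigenvalues_def M_def)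
  ultimately show ?thesis using that by blast
qed

subsection \<open>Projected linear vector fields\<close>

text \<open>The projected field in terms of \<open>q\<close> alone, with no representative
  \<open>x\<close>. It is polynomial on the whole matrix space, hence differentiable there.\<close>

definition projective_field :: "real ^ 'n ^ 'n \<Rightarrow> real ^ 'n ^ 'n \<Rightarrow> real ^ 'n ^ 'n" where
  "projective_field M q = M ** q + q ** transpose M - q ** (M + transpose M) ** q"

lemma RP_proj_outer: "RP_proj x = (1 / (norm x)\<^sup>2) *\<^sub>R outer x x"
  by (simp add: RP_proj_def outer_def vec_eq_iff)

lemma RP_idempotent:
  assumes "q \<in> RP"
  shows "q ** q = q"
proof -
  obtain x where x: "x \<noteq> 0" "q = RP_proj x" using assms by (auto simp: RP_def)
  have "q ** q = ((x \<bullet> x) / ((norm x)\<^sup>2 * (norm x)\<^sup>2)) *\<^sub>R outer x x"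
    by (simp add: x(2) RP_proj_outer matrix_scalar_ac scalar_matrix_assoc[symmetric] mult_outer
        outer_mult_vec outer_scaleR_left scaleR_matrix_vector_assoc[symmetric])
  also have "\<dots> = q"
    using x by (simp add: RP_proj_outer power2_norm_eq_inner)
  finally show ?thesis .
qed

lemma RP_symmetric: "q \<in> RP \<Longrightarrow> transpose q = q"
  by (auto simp: RP_def RP_proj_def transpose_def vec_eq_iff mult_ac)

lemma RP_proj_curve_derivative:
  assumes "x \<noteq> 0"
  shows "((\<lambda>t. RP_proj (x + t *\<^sub>R y)) has_vector_derivative frechet_derivative RP_proj (at x) y) (at 0)"
proof -
  have "((\<lambda>t. x + t *\<^sub>R y) has_derivative (\<lambda>t. t *\<^sub>R y)) (at 0)"
    by (auto intro!: derivative_eq_intros)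
  moreover have D: "(RP_proj has_derivative frechet_derivative RP_proj (at x)) (at (x + 0 *\<^sub>R y))"
    using RP_proj_differentiable[OF assms] by (simp add: frechet_derivative_works)
  ultimately have "((\<lambda>t. RP_proj (x + t *\<^sub>R y)) has_derivative
      (\<lambda>t. frechet_derivative RP_proj (at x) (t *\<^sub>R y))) (at 0)"
    by (rule has_derivative_compose)
  then show ?thesis
    using has_derivative_bounded_linear[OF D] by (simp add: has_vector_derivative_def linear_simps)
qed

text \<open>By orthogonality the squared norm of \<open>x + t y\<close> has no linear term in
  \<open>t\<close>, so only the numerator contributes to the derivative at
  \<open>t = 0\<close>.\<close>

lemma frechet_derivative_RP_proj:
  assumes "x \<noteq> 0" "x \<bullet> y = 0"
  shows "frechet_derivative RP_proj (at x) y = (1 / (norm x)\<^sup>2) *\<^sub>R (outer x y + outer y x)"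
proof -
  have sq: "(norm (x + t *\<^sub>R y))\<^sup>2 = x \<bullet> x + t\<^sup>2 * (y \<bullet> y)" for t
    unfolding power2_norm_eq_inner using assms(2)
    by (simp add: inner_add_left inner_add_right inner_commute power2_eq_square)
  have "((\<lambda>t. (1 / (x \<bullet> x + t\<^sup>2 * (y \<bullet> y))) *\<^sub>R
      (outer x x + t *\<^sub>R (outer x y + outer y x) + t\<^sup>2 *\<^sub>R outer y y)) has_vector_derivative
      (1 / (x \<bullet> x)) *\<^sub>R (outer x y + outer y x)) (at 0)"
    unfolding has_vector_derivative_def using assms(1)
    by (auto intro!: derivative_eq_intros simp: fun_eq_iff)
  moreover have "(1 / (x \<bullet> x + t\<^sup>2 * (y \<bullet> y))) *\<^sub>R
      (outer x x + t *\<^sub>R (outer x y + outer y x) + t\<^sup>2 *\<^sub>R outer y y) = RP_proj (x + t *\<^sub>R y)" for t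
    unfolding RP_proj_outer sq
    by (simp add: outer_add_left outer_add_right outer_scaleR_left outer_scaleR_right
        power2_eq_square algebra_simps)
  ultimately show ?thesis
    using vector_derivative_unique_at[OF RP_proj_curve_derivative[OF assms(1), of y]]
    by (simp add: power2_norm_eq_inner)
qed

text \<open>The tangential part of \<open>M x\<close> contributes
  \<open>M q + q M^T - 2 \<alpha> q\<close>. The last term is \<open>q (M + M^T) q\<close>, since
  compressing a matrix to a line multiplies \<open>q\<close> by its Rayleigh quotient.\<close>

lemma proj_field_eq:
  assumes "q \<in> RP"
  shows "proj_field M q = projective_field M q"
proof -
  obtain x where x: "x \<noteq> 0" "q = RP_proj x" using assms by (auto simp: RP_def)
  define \<alpha> where "\<alpha> = (x \<bullet> (M *v x)) / (norm x)\<^sup>2"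
  define y where "y = M *v x - \<alpha> *\<^sub>R x"
  have "x \<bullet> y = 0"
    using x(1) by (simp add: y_def \<alpha>_def inner_diff_right power2_norm_eq_inner)
  then have "proj_field M q = (1 / (norm x)\<^sup>2) *\<^sub>R (outer x y + outer y x)"
    using x proj_field_RP_proj[OF x(1), of M] frechet_derivative_RP_proj[OF x(1), of y]
    by (simp add: y_def \<alpha>_def)
  also have "\<dots> = M ** q + q ** transpose M - (2 * \<alpha>) *\<^sub>R q"
    by (simp add: x(2) RP_proj_outer y_def matrix_ring_simps mult_outer outer_mult
        outer_diff_left outer_diff_right outer_scaleR_left outer_scaleR_right
        vector_transpose_matrix scaleR_matrix_vector_assoc[symmetric]) (simp add: vec_eq_iff algebra_simps)
  also have "(2 * \<alpha>) *\<^sub>R q = q ** (M + transpose M) ** q"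
  proof -
    define N where "N = M + transpose M"
    have "x \<bullet> (N *v x) = 2 * (x \<bullet> (M *v x))"
      by (simp add: N_def matrix_vector_mult_add_rdistrib inner_add_right dot_lmul_matrix
          inner_commute[of x "x v* M"])
    moreover have "q ** N ** q = ((x \<bullet> (N *v x)) / (norm x)\<^sup>2) *\<^sub>R q"
      by (simp add: x(2) RP_proj_outer matrix_scalar_ac scalar_matrix_assoc[symmetric]
          matrix_mul_assoc[symmetric] mult_outer outer_mult outer_mult_vec outer_scaleR_left
          scaleR_matrix_vector_assoc[symmetric] dot_lmul_matrix)
    ultimately show ?thesis by (simp add: N_def \<alpha>_def)
  qed
  finally show ?thesis by (simp add: projective_field_def)
qed

lemma proj_field_tangent:
  assumes "q \<in> RP"
  shows "proj_field M q \<in> tangent_space RP q"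
proof -
  obtain x where x: "x \<noteq> 0" "q = RP_proj x" using assms by (auto simp: RP_def)
  define y where "y = M *v x - ((x \<bullet> (M *v x)) / (norm x)\<^sup>2) *\<^sub>R x"
  have xy: "x \<bullet> y = 0"
    using x(1) by (simp add: y_def inner_diff_right power2_norm_eq_inner)
  \<comment> \<open>The curve must stay in \<open>RP\<close> for every \<open>t\<close>, so the line
    has to miss the origin.\<close>
  have "x + t *\<^sub>R y \<noteq> 0" for t
  proof
    assume "x + t *\<^sub>R y = 0"
    then have "x \<bullet> (x + t *\<^sub>R y) = 0" by simp
    then show False using x(1) xy by (simp add: inner_add_right)
  qed
  then have "\<forall>t. RP_proj (x + t *\<^sub>R y) \<in> RP" by (auto simp: RP_def)
  moreover have "((\<lambda>t. RP_proj (x + t *\<^sub>R y)) has_vector_derivative proj_field M q) (at 0)"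
    using RP_proj_curve_derivative[OF x(1), of y] proj_field_RP_proj[OF x(1), of M] x(2)
    by (simp add: y_def)
  ultimately show ?thesis
    unfolding tangent_space_def using x(2) by (auto intro!: exI[of _ "\<lambda>t. RP_proj (x + t *\<^sub>R y)"])
qed

section \<open>Tangent vectors and brackets on projective space\<close>

lemma bounded_bilinear_matrix_mult:
  "bounded_bilinear ((**) :: real ^ 'n ^ 'm \<Rightarrow> real ^ 'k ^ 'n \<Rightarrow> real ^ 'k ^ 'm)"
  unfolding bilinear_conv_bounded_bilinear[symmetric] bilinear_def
  by (auto intro!: linearI simp: matrix_ring_simps)

lemma bounded_linear_transpose: "bounded_linear (transpose :: real ^ 'n ^ 'm \<Rightarrow> real ^ 'm ^ 'n)"
  unfolding linear_conv_bounded_linear[symmetric]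
  by (auto intro!: linearI simp: transpose_add transpose_scalar)

text \<open>A tangent vector \<open>v\<close> at an orthogonal projection \<open>q\<close> is symmetric with \<open>v = v q + q v\<close>,
  hence \<open>q v q = 0\<close> and \<open>v\<close> is the value at \<open>q\<close> of the field of the matrix \<open>v\<close> itself.\<close>
lemma tangent_eq_proj_field:
  assumes "v \<in> tangent_space RP q"
  shows "v = proj_field v q"
proof -
  obtain \<gamma> :: "real \<Rightarrow> real ^ 'a ^ 'a" where g: "\<And>t. \<gamma> t \<in> RP" "\<gamma> 0 = q"
    "(\<gamma> has_vector_derivative v) (at 0)"
    using assms by (auto simp: tangent_space_def)
  then have q: "q \<in> RP" by metis
  \<comment> \<open>Differentiate the idempotence of the curve here and its symmetry below.\<close>
  have "((\<lambda>t. \<gamma> t ** \<gamma> t) has_vector_derivative (\<gamma> 0 ** v + v ** \<gamma> 0)) (at 0)"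
    by (rule bounded_bilinear.has_vector_derivative[OF bounded_bilinear_matrix_mult g(3) g(3)])
  then have v: "v = q ** v + v ** q"
    using g vector_derivative_unique_at by (fastforce simp: RP_idempotent)
  have "((\<lambda>t. transpose (\<gamma> t)) has_vector_derivative transpose v) (at 0)"
    by (rule bounded_linear.has_vector_derivative[OF bounded_linear_transpose g(3)])
  then have sym: "transpose v = v"
    using g vector_derivative_unique_at by (fastforce simp: RP_symmetric)
  have "q ** v ** q = q ** (q ** v + v ** q) ** q" using v by simp
  also have "\<dots> = q ** v ** q + q ** v ** q"
    using RP_idempotent[OF q] by (simp add: matrix_add_ldistrib matrix_add_rdistrib matrix_mul_assoc)
      (simp flip: matrix_mul_assoc)
  finally have "q ** v ** q = 0" by simp
  then show ?thesis
    unfolding proj_field_eq[OF q] projective_field_def sym matrix_add_ldistrib matrix_add_rdistrib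
    using v by (simp add: add.commute)
qed

definition projective_field_deriv where
  "projective_field_deriv M q h =
     M ** h + h ** transpose M - (h ** (M + transpose M) ** q + q ** (M + transpose M) ** h)"

lemma projective_field_has_derivative:
  "(projective_field M has_derivative projective_field_deriv M q) (at q within S)"
proof -
  note D = bounded_bilinear.FDERIV[OF bounded_bilinear_matrix_mult]
  let ?T = "M + transpose M"
  have i: "((\<lambda>q. q) has_derivative (\<lambda>h. h)) (at q within S)" by (rule has_derivative_ident)
  have c: "((\<lambda>q. C) has_derivative (\<lambda>h. 0)) (at q within S)" for C :: "real ^ 'a ^ 'a"
    by (rule has_derivative_const)
  have "((\<lambda>q. M ** q + q ** transpose M - q ** ?T ** q) has_derivative
     (\<lambda>h. (M ** h + 0 ** q) + (q ** 0 + h ** transpose M) -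
       ((q ** ?T) ** h + (q ** 0 + h ** ?T) ** q))) (at q within S)"
    by (intro has_derivative_add has_derivative_diff D i c)
  then show ?thesis
    by (simp add: projective_field_def[abs_def] projective_field_deriv_def[abs_def] add.commute)
qed

text \<open>The derivative chosen within \<open>RP\<close> is pinned down on tangent vectors, where
  it is that of the polynomial extension.\<close>

lemma frechet_derivative_proj_field:
  assumes "q \<in> RP" "v \<in> tangent_space RP q"
  shows "frechet_derivative (proj_field M) (at q within RP) v = projective_field_deriv M q v"
proof -
  have D: "(proj_field M has_derivative projective_field_deriv M q) (at q within RP)"
    by (rule has_derivative_transform[OF assms(1) _ projective_field_has_derivative])
      (rule proj_field_eq)
  then have "(proj_field M has_derivative frechet_derivative (proj_field M) (at q within RP))
      (at q within RP)"
    by (metis differentiableI frechet_derivative_works)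
  from derivative_within_tangent_unique[OF this D assms(2)] show ?thesis .
qed

text \<open>The order is reversed as for the linear fields \<open>M x\<close> and
  \<open>N x\<close>, whose bracket is \<open>(N M - M N) x\<close>. The cubic terms in
  \<open>q\<close> are symmetric in \<open>M\<close> and \<open>N\<close> and cancel.\<close>

lemma lie_bracket_proj_field:
  "lie_bracket RP (proj_field M) (proj_field N) = proj_field (N ** M - M ** N)"
proof
  fix q
  show "lie_bracket RP (proj_field M) (proj_field N) q = proj_field (N ** M - M ** N) q"
  proof (cases "q \<in> RP")
    case True
    have "lie_bracket RP (proj_field M) (proj_field N) q =
        projective_field_deriv N q (projective_field M q) - projective_field_deriv M q (projective_field N q)"
      using True frechet_derivative_proj_field[OF True proj_field_tangent[OF True]]
      by (simp add: lie_bracket_def proj_field_eq)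
    also have "\<dots> = projective_field (N ** M - M ** N) q"
      unfolding projective_field_deriv_def projective_field_def
      by (simp add: matrix_ring_simps)
    finally show ?thesis using True by (simp add: proj_field_eq)
  qed (simp add: lie_bracket_def proj_field_def)
qed

lemma proj_field_add: "proj_field (M + N) q = proj_field M q + proj_field N q"
  by (cases "q \<in> RP") (simp_all add: proj_field_eq projective_field_def matrix_ring_simps,
      simp add: proj_field_def)

lemma proj_field_scaleR: "proj_field (c *\<^sub>R M) q = c *\<^sub>R proj_field M q"
  by (cases "q \<in> RP") (simp_all add: proj_field_eq projective_field_def matrix_ring_simps
      scaleR_right_distrib scaleR_right_diff_distrib, simp add: proj_field_def)

lemma proj_field_mat_1: "proj_field (mat 1) q = 0"
proof (cases "q \<in> RP")
  case True
  then show ?thesis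
    unfolding proj_field_eq[OF True] projective_field_def transpose_mat matrix_add_ldistrib
      matrix_add_rdistrib matrix_mul_lid matrix_mul_rid RP_idempotent[OF True] by simp
qed (simp add: proj_field_def)

text \<open>The matrices whose projected field lies in the generated Lie algebra of fields form a
  matrix Lie algebra containing both generators, hence are all matrices; their fields attain every
  tangent vector.\<close>

lemma LARC_subset_PLARC: "LARC (A - c *\<^sub>R mat 1) b \<subseteq> PLARC A b"
proof
  fix K assume K: "K \<in> LARC (A - c *\<^sub>R mat 1) b"
  let ?G = "{proj_field A, proj_field (b ** K)}"
  let ?F = "field_lie_algebra RP hull ?G"
  have zero: "proj_field 0 = (\<lambda>q. 0)"
    using proj_field_scaleR[of 0 0] by auto
  \<comment> \<open>The projected linear fields form a Lie algebra, so the generated one contains no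
    others and its values are tangent.\<close>
  have "field_lie_algebra RP (range proj_field)"
    unfolding field_lie_algebra_def
    by (auto simp: lie_bracket_proj_field proj_field_add[symmetric] proj_field_scaleR[symmetric]
        zero[symmetric])
  then have sub: "?F \<subseteq> range proj_field"
    by (intro hull_minimal) auto
  have F: "field_lie_algebra RP ?F"
    by (rule hull_in) (simp add: field_lie_algebra_def)
  define L where "L = {M. proj_field M \<in> ?F}"
  have shift: "proj_field (A - c *\<^sub>R mat 1) = proj_field A"
    using proj_field_add[of "A - c *\<^sub>R mat 1" "c *\<^sub>R mat 1"]
    by (simp add: fun_eq_iff proj_field_scaleR proj_field_mat_1)
  have "matrix_lie_algebra L"
    unfolding matrix_lie_algebra_def subspace_def L_def
    using F by (auto simp: field_lie_algebra_def zero proj_field_add[abs_def]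
        proj_field_scaleR[abs_def] lie_bracket_proj_field[symmetric])
  moreover have "{A - c *\<^sub>R mat 1, b ** K} \<subseteq> L"
    using hull_subset[of ?G] by (auto simp: L_def shift)
  ultimately have "matrix_lie_algebra hull {A - c *\<^sub>R mat 1, b ** K} \<subseteq> L"
    by (intro hull_minimal)
  then have all: "proj_field M \<in> ?F" for M
    using K by (auto simp: LARC_def L_def)
  have "(\<lambda>X. X q) ` ?F = tangent_space RP q" if q: "q \<in> RP" for q
  proof
    show "(\<lambda>X. X q) ` ?F \<subseteq> tangent_space RP q"
      using sub proj_field_tangent[OF q] by blast
    show "tangent_space RP q \<subseteq> (\<lambda>X. X q) ` ?F"
      using all tangent_eq_proj_field by blast
  qed
  then show "K \<in> PLARC A b" by (simp add: PLARC_def)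
qed

subsection \<open>Density\<close>

lemma linear_funpow: "linear f \<Longrightarrow> linear (f ^^ n)" for f :: "'a::real_vector \<Rightarrow> 'a"
proof (induction n)
  case (Suc n)
  then show ?case using linear_compose[OF Suc.IH[OF Suc.prems] Suc.prems] by (simp add: o_def)
qed (simp add: linear_id)

text \<open>Let \<open>d\<close> be the dimension. A row \<open>k\<close> with \<open>k A\<^sup>i b = 0\<close> for \<open>i < d - 1\<close> and
  \<open>k A\<^sup>d\<^sup>-\<^sup>1 b \<noteq> 0\<close> is observable: its Hankel matrix \<open>(k A\<^sup>i\<^sup>+\<^sup>j b)\<close> is antitriangular.\<close>
lemma observable_row_exists:
  fixes A :: "real ^ 'n ^ 'n" and b :: "real ^ 1 ^ 'n"
  assumes d: "CARD('n) \<ge> 2" and ctr: "controllable A b"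
  obtains k where "observable A k" "k \<bullet> column 1 b = 0"
proof -
  define e where "e i = (((*v) A) ^^ i) (column 1 b)" for i
  obtain m where m: "CARD('n) = Suc m" "m > 0" using d by (cases "CARD('n)") auto
  have "dim (e ` {..<m}) \<le> card (e ` {..<m})" by (rule dim_le_card') simp
  also have "\<dots> \<le> m" using card_image_le[of "{..<m}" e] by simp
  also have "m < DIM(real ^ 'n)" using m by simp
  finally have dim: "dim (e ` {..<m}) < DIM(real ^ 'n)" .
  obtain k where k: "k \<noteq> 0" "\<And>y. y \<in> span (e ` {..<m}) \<Longrightarrow> orthogonal k y"
    using orthogonal_to_subspace_exists[OF dim] by metis
  have low: "k \<bullet> e i = 0" if "i < m" for i
    using k(2)[of "e i"] that by (simp add: orthogonal_def span_base)
  have span: "span (e ` {..<CARD('n)}) = UNIV"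
  proof -
    have "e ` {..<CARD('n)} = {(((*v) A) ^^ k) (column 1 b) | k. k < CARD('n)}"
      by (auto simp: e_def)
    then show ?thesis using ctr by (simp add: controllable_def)
  qed
  have top: "k \<bullet> e m \<noteq> 0"
  proof
    assume "k \<bullet> e m = 0"
    then have "orthogonal k y" if "y \<in> e ` {..<CARD('n)}" for y
      using that low m by (auto simp: orthogonal_def less_Suc_eq)
    then have "orthogonal k k"
      using orthogonal_to_span[of k "e ` {..<CARD('n)}" k] span by auto
    then show False using k(1) by (simp add: orthogonal_self)
  qed
  have pow: "linear (((*v) A) ^^ n)" for n by (rule linear_funpow) simp
  have shift: "(((*v) A) ^^ n) (e i) = e (n + i)" for n i by (simp add: e_def funpow_add)
  have "observable A k"
    unfolding observable_def
  proof (intro allI impI)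
    fix v assume v: "\<forall>i. k \<bullet> (((*v) A) ^^ i) v = 0"
    \<comment> \<open>Peel off the coefficient of the last vector: \<open>k A^(m - j)\<close> kills
      each \<open>e i\<close> with \<open>i < j\<close>, as its index stays below \<open>m\<close>,
      but takes the nonzero value \<open>k \<bullet> e m\<close> on \<open>e j\<close>.\<close>
    have "v = 0" if "j \<le> Suc m" "v \<in> span (e ` {..<j})" for j
      using that
    proof (induction j)
      case (Suc j)
      then obtain c where c: "v - c *\<^sub>R e j \<in> span (e ` {..<j})"
        by (auto simp: lessThan_Suc span_breakdown_eq)
      have "k \<bullet> (((*v) A) ^^ (m - j)) u = 0" if "u \<in> span (e ` {..<j})" for u
      proof (rule span_induct[OF that])
        show "subspace {u. k \<bullet> ((*v) A ^^ (m - j)) u = 0}"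
          using linear_add[OF pow] linear_cmul[OF pow] linear_0[OF pow]
          by (auto simp: subspace_def inner_add_right)
        show "k \<bullet> ((*v) A ^^ (m - j)) u = 0" if "u \<in> e ` {..<j}" for u
          using that Suc.prems(1) by (auto simp: shift intro!: low)
      qed
      from this[OF c] have "k \<bullet> ((((*v) A) ^^ (m - j)) v - c *\<^sub>R e m) = 0"
        using Suc.prems(1) by (simp add: linear_diff[OF pow] linear_cmul[OF pow] shift)
      then have "c = 0" using v top by (simp add: inner_diff_right)
      then show ?case using c Suc by simp
    qed auto
    from this[of "Suc m"] show "v = 0" using span m by simp
  qed
  \<comment> \<open>Index \<open>0\<close> lies below \<open>m\<close> because the dimension is at
    least two.\<close>
  moreover have "k \<bullet> column 1 b = 0" using low[of 0] m by (simp add: e_def)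
  ultimately show ?thesis using that by blast
qed

text \<open>The rows \<open>k0 Q\<close> with \<open>Q\<close> in the commutant of \<open>A\<close>
  form an \<open>A\<close>-invariant subspace containing \<open>k0\<close>, so observability makes
  them all rows.\<close>

lemma row_eq_observable_row_mult_commuting:
  assumes "observable A k0"
  obtains Q where "A ** Q = Q ** A" "k = k0 v* Q"
proof -
  have "{k0 v* Q | Q. A ** Q = Q ** A} = UNIV"
  proof (rule observable_invariant_subspace[OF assms])
    show "subspace {k0 v* Q | Q. A ** Q = Q ** A}"
      unfolding subspace_def
    proof (intro conjI ballI allI)
      show "0 \<in> {k0 v* Q | Q. A ** Q = Q ** A}"
        by (auto intro!: exI[of _ 0])
    next
      fix x y assume "x \<in> {k0 v* Q | Q. A ** Q = Q ** A}" "y \<in> {k0 v* Q | Q. A ** Q = Q ** A}"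
      then obtain P Q where "x = k0 v* P" "A ** P = P ** A" "y = k0 v* Q" "A ** Q = Q ** A" by auto
      then show "x + y \<in> {k0 v* Q | Q. A ** Q = Q ** A}"
        by (auto intro!: exI[of _ "P + Q"] simp: matrix_ring_simps vector_matrix_mult_add_rdistrib)
    next
      fix c x assume "x \<in> {k0 v* Q | Q. A ** Q = Q ** A}"
      then obtain P where "x = k0 v* P" "A ** P = P ** A" by auto
      then show "c *\<^sub>R x \<in> {k0 v* Q | Q. A ** Q = Q ** A}"
        by (auto intro!: exI[of _ "c *\<^sub>R P"] simp: matrix_ring_simps vector_scaleR_matrix_ac)
    qed
    show "k0 \<in> {k0 v* Q | Q. A ** Q = Q ** A}"
      by (auto intro!: exI[of _ "mat 1"])
    fix w assume "w \<in> {k0 v* Q | Q. A ** Q = Q ** A}"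
    then obtain Q where "w = k0 v* Q" "A ** Q = Q ** A" by auto
    then show "w v* A \<in> {k0 v* Q | Q. A ** Q = Q ** A}"
      by (auto intro!: exI[of _ "Q ** A"] simp: vector_matrix_mul_assoc matrix_mul_assoc)
  qed
  then show ?thesis using that by blast
qed

text \<open>Writing \<open>k = k0 Q\<close> with \<open>Q\<close> in the commutant of \<open>A\<close>, the row \<open>k + t k0 = k0 (Q + t)\<close> is
  observable unless \<open>- t\<close> is an eigenvalue of \<open>Q\<close>.\<close>
lemma observable_perturbation:
  assumes k0: "observable A k0"
  shows "\<exists>F. finite F \<and> (\<forall>t. t \<notin> F \<longrightarrow> observable A (k + t *\<^sub>R k0))"
proof -
  obtain Q where Q: "A ** Q = Q ** A" "k = k0 v* Q"
    using row_eq_observable_row_mult_commuting[OF k0] by blast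
  define F where "F = uminus ` {z. \<exists>v. v \<noteq> 0 \<and> Q *v v = z *s v}"
  have "finite F" unfolding F_def by (intro finite_imageI finite_eigenvalues)
  moreover have "observable A (k + t *\<^sub>R k0)" if t: "t \<notin> F" for t
    unfolding observable_def
  proof (intro allI impI)
    fix v assume v: "\<forall>i. (k + t *\<^sub>R k0) \<bullet> (((*v) A) ^^ i) v = 0"
    have Qi: "Q *v (((*v) A) ^^ i) v = (((*v) A) ^^ i) (Q *v v)" for i
      by (induction i) (auto simp: matrix_vector_mul_assoc Q(1)[symmetric], simp flip: matrix_vector_mul_assoc)
    have lin: "linear (((*v) A) ^^ i)" for i by (rule linear_funpow) simp
    have "k0 \<bullet> (((*v) A) ^^ i) (Q *v v + t *\<^sub>R v) = 0" for i
      using v[rule_format, of i] by (simp add: linear_add[OF lin] linear_cmul[OF lin] Q(2)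
          inner_add_left inner_add_right dot_lmul_matrix Qi)
    then have "Q *v v + t *\<^sub>R v = 0" using k0 by (auto simp: observable_def)
    then have "Q *v v = (- t) *s v" by (simp add: eq_neg_iff_add_eq_0 scalar_mult_eq_scaleR)
    moreover have "- t \<notin> {z. \<exists>v. v \<noteq> 0 \<and> Q *v v = z *s v}"
    proof
      assume "- t \<in> {z. \<exists>v. v \<noteq> 0 \<and> Q *v v = z *s v}"
      then have "- (- t) \<in> F" unfolding F_def by (rule imageI)
      then show False using t by simp
    qed
    ultimately show "v = 0" by blast
  qed
  ultimately show ?thesis by blast
qed

text \<open>A cofinite set of reals is dense, and \<open>K\<close> is the point of the line at
  \<open>t = 0\<close>.\<close>

lemma closure_cofinite_line:
  fixes K D :: "'a::real_normed_vector"
  assumes "finite F" "\<And>t. t \<notin> F \<Longrightarrow> K + t *\<^sub>R D \<in> S"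
  shows "K \<in> closure S"
proof -
  have "(\<lambda>t. K + t *\<^sub>R D) ` closure (- F) \<subseteq> closure S"
    using assms(2) closure_subset[of S] by (intro image_closure_subset continuous_intros) auto
  moreover have "closure (- F) = UNIV"
    using assms(1) by (simp add: closure_complement empty_interior_finite)
  ultimately show ?thesis by (auto simp: image_subset_iff dest: spec[of _ 0])
qed

text \<open>Two perturbations: moving along \<open>k0\<close>, which annihilates \<open>b\<close>,
  reaches observability without changing a nonzero \<open>k b\<close>; moving along \<open>b\<close>
  makes \<open>k b\<close> nonzero.\<close>

lemma closure_PLARC:
  fixes A :: "real ^ 'n ^ 'n" and b :: "real ^ 1 ^ 'n"
  assumes d: "CARD('n) \<ge> 2" and ctr: "controllable A b"
  shows "closure (PLARC A b) = UNIV"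
proof -
  define x where "x = column 1 b"
  define R where "R = {K :: real ^ 'n ^ 1. (K $ 1) \<bullet> x \<noteq> 0}"
  obtain k0 where k0: "observable A k0" "k0 \<bullet> x = 0"
    using observable_row_exists[OF d ctr] x_def by blast
  have "x \<noteq> 0"
  proof
    assume "x = 0"
    then have "{0} = (UNIV :: (real ^ 'n) set)"
      by (intro controllable_invariant_subspace[OF ctr]) (auto simp: x_def subspace_def)
    then have "axis undefined 1 = (0 :: real ^ 'n)" by blast
    then show False by simp
  qed
  have "R \<subseteq> closure (PLARC A b)"
  proof
    fix K assume K: "K \<in> R"
    obtain F where F: "finite F" "\<And>t. t \<notin> F \<Longrightarrow> observable A (K $ 1 + t *\<^sub>R k0)"
      using observable_perturbation[OF k0(1)] by blast
    have "K + t *\<^sub>R (\<chi> i. k0) \<in> PLARC A b" if "t \<notin> F" for t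
    proof -
      have "K + t *\<^sub>R (\<chi> i. k0) \<in> LARC (A - 0 *\<^sub>R mat 1) b"
        using F(2)[OF that] K k0(2) by (intro LARC_I ctr) (auto simp: R_def x_def inner_add_left)
      then show ?thesis using LARC_subset_PLARC by blast
    qed
    then show "K \<in> closure (PLARC A b)" by (rule closure_cofinite_line[OF F(1)])
  qed
  moreover have "K \<in> closure R" for K
  proof (rule closure_cofinite_line)
    \<comment> \<open>The pairing with \<open>x\<close> is affine in \<open>t\<close> with slope
      \<open>x \<bullet> x\<close>, so it vanishes for a single \<open>t\<close>.\<close>
    show "finite {- ((K $ 1) \<bullet> x) / (x \<bullet> x)}" by simp
    show "K + t *\<^sub>R (\<chi> i. x) \<in> R" if "t \<notin> {- ((K $ 1) \<bullet> x) / (x \<bullet> x)}" for t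
      using that \<open>x \<noteq> 0\<close> by (auto simp: R_def inner_add_left field_simps)
  qed
  ultimately show ?thesis using closure_mono[of R "closure (PLARC A b)"] by auto
qed

section \<open>The spectral criterion and the density combined\<close>

theorem theorem6p1:
  fixes A :: "real ^ 'n ^ 'n" and b :: "real ^ 1 ^ 'n"
  assumes "CARD('n) \<ge> 2"
    and "controllable A b"
  shows "(\<exists>c > 0. \<forall>K :: real ^ 'n ^ 1.
            (\<forall>z \<in> eigenvalues (A + b ** K). Re z < - c) \<or>
            (\<forall>z \<in> eigenvalues (A + b ** K). Re z > c) \<longrightarrow>
            K \<in> LARC (A - trace A *\<^sub>R mat 1) b)
    \<and> closure (PLARC A b) = UNIV"
proof
  obtain B where B: "\<And>z. z \<in> eigenvalues A \<Longrightarrow> \<bar>Re z\<bar> \<le> B" by (rule eigenvalues_bounded) blast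
  \<comment> \<open>The first summand separates the trace of \<open>A + b ** K\<close> from that of
    \<open>A\<close>, the second separates the spectra, and the \<open>1\<close> makes both
    comparisons strict and \<open>c\<close> positive.\<close>
  define c where "c = \<bar>trace A\<bar> + \<bar>B\<bar> + 1"
  have "K \<in> LARC (A - trace A *\<^sub>R mat 1) b"
    if K: "(\<forall>z \<in> eigenvalues (A + b ** K). Re z < - c) \<or> (\<forall>z \<in> eigenvalues (A + b ** K). Re z > c)"
    for K :: "real ^ 'n ^ 1"
  proof (rule LARC_I[OF assms(2)])
    show "observable A (K $ 1)"
    proof (rule ccontr)
      assume "\<not> observable A (K $ 1)"
      then obtain z where "z \<in> eigenvalues A" "z \<in> eigenvalues (A + b ** K)"
        by (rule not_observable_common_eigenvalue)
      with B[of z] K show False by (auto simp: c_def)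
    qed
    have "c \<le> \<bar>trace (A + b ** K)\<bar>" by (rule abs_trace_ge[OF _ K]) (simp add: c_def)
    also have "trace (A + b ** K) = trace A + (K $ 1) \<bullet> column 1 b"
      by (simp add: trace_add column_mult_row trace_outer inner_commute)
    finally show "(K $ 1) \<bullet> column 1 b \<noteq> 0" by (auto simp: c_def)
  qed
  then show "\<exists>c>0. \<forall>K :: real ^ 'n ^ 1.
      (\<forall>z \<in> eigenvalues (A + b ** K). Re z < - c) \<or> (\<forall>z \<in> eigenvalues (A + b ** K). Re z > c) \<longrightarrow>
      K \<in> LARC (A - trace A *\<^sub>R mat 1) b"
    by (intro exI[of _ c]) (auto simp: c_def)
qed (rule closure_PLARC[OF assms])

end
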